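(* Let $q>p>1$, $\mu>0$, let $D\subset\mathbb{R}^n$ be a bounded smooth domain and let $a$ be a nonnegative smooth function on $\overline D$. Consider $u_t=\Delta u+\mu u^p-a(x)u^q$ in $D\times(0,T^* )$, $u(x,0)=u_0(x)\ge 0$, $u_0\in C(\overline D)$. (1) (Dirichlet problem, $u=0$ on $\partial D\times(0,T^* )$.) Assume that at every zero point of $a$ the order $\sigma$ of the zero of $a$ satisfies $\sigma\ge 2(q-p)(p-1)^{-1}$. If the nonnegative classical solution $u$ blows up in finite time, then every blowup point of $u$ is a zero point of $a$. (2) (Neumann problem, $\frac{\partial u}{\partial n}=0$ on $\partial D\times(0,T^* )$.) Assume that for every $x\in\partial D$ either $\frac{\partial a}{\partial n}(x)\le 0$ or $a(x)=0$. If the nonnegative classical solution $u$ blows up in finite time, then every blowup point of $u$ is a zero point of $a$.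
   Context: $n$ in $\partial/\partial n$ denotes the unit exterior normal vector on $\partial D$. $T^*\in(0,\infty]$ is the maximal existence time of the unique classical solution; if $T^*<\infty$ then $\lim_{t\to T^*}\|u(\cdot,t)\|_\infty=\infty$, and the solution is said to blow up in finite time with blowup time $T^*$. A point $x_0\in\overline D$ is a blowup point if there are sequences $x_k\in\overline D$, $t_k\in(0,T^* )$ with $x_k\to x_0$, $t_k\to T^*$ and $|u(x_k,t_k)|\to\infty$. A zero point of $a$ is a point of $\overline D$ where $a=0$; the order of the zero of $a$ at a zero point $x_0$ is its vanishing order there, i.e. $\sup\{s\ge0: a(x)=O(|x-x_0|^s)\text{ as }x\to x_0\}$. *)

theory Defs
  imports "HOL-Analysis.Analysis" "HOL-Library.Landau_Symbols"
begin

section \<open>Smooth functions and smooth domains\<close>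

definition dir_deriv :: "'a::euclidean_space \<Rightarrow> ('a \<Rightarrow> real) \<Rightarrow> 'a \<Rightarrow> real" where
  "dir_deriv b f x = frechet_derivative f (at x) b"

definition gradient :: "('a::euclidean_space \<Rightarrow> real) \<Rightarrow> 'a \<Rightarrow> 'a" where
  "gradient f x = (\<Sum>b\<in>Basis. dir_deriv b f x *\<^sub>R b)"

definition laplacian :: "('a::euclidean_space \<Rightarrow> real) \<Rightarrow> 'a \<Rightarrow> real" where
  "laplacian f x = (\<Sum>b\<in>Basis. dir_deriv b (dir_deriv b f) x)"

text \<open>Intended for open sets \<open>U\<close> only.\<close>

primrec Ck_on :: "nat \<Rightarrow> 'a::euclidean_space set \<Rightarrow> ('a \<Rightarrow> real) \<Rightarrow> bool" where
  "Ck_on 0 U f \<longleftrightarrow> continuous_on U f"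
| "Ck_on (Suc k) U f \<longleftrightarrow>
     (\<forall>x\<in>U. f differentiable (at x)) \<and> (\<forall>b\<in>Basis. Ck_on k U (dir_deriv b f))"

definition smooth_on :: "'a::euclidean_space set \<Rightarrow> ('a \<Rightarrow> real) \<Rightarrow> bool" where
  "smooth_on U f \<longleftrightarrow> (\<forall>k. Ck_on k U f)"

text \<open>Smoothness up to the boundary: \<open>f\<close> restricted to the (closed) set \<open>K\<close> is the restriction of
  a smooth function on an open neighbourhood of \<open>K\<close>.  Values of \<open>f\<close> off \<open>K\<close> do not matter.\<close>

definition smooth_on_closed :: "'a::euclidean_space set \<Rightarrow> ('a \<Rightarrow> real) \<Rightarrow> bool" where
  "smooth_on_closed K f \<longleftrightarrow>
     (\<exists>V g. open V \<and> K \<subseteq> V \<and> smooth_on V g \<and> (\<forall>x\<in>K. f x = g x))"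

definition local_defining_function ::
  "'a::euclidean_space set \<Rightarrow> 'a \<Rightarrow> 'a set \<Rightarrow> ('a \<Rightarrow> real) \<Rightarrow> bool" where
  "local_defining_function D x U \<phi> \<longleftrightarrow>
     open U \<and> x \<in> U \<and> smooth_on U \<phi> \<and> (\<forall>y\<in>U. gradient \<phi> y \<noteq> 0) \<and>
     D \<inter> U = {y \<in> U. \<phi> y < 0}"

definition bounded_smooth_domain :: "'a::euclidean_space set \<Rightarrow> bool" where
  "bounded_smooth_domain D \<longleftrightarrow>
     D \<noteq> {} \<and> open D \<and> connected D \<and> bounded D \<and>
     (\<forall>x\<in>frontier D. \<exists>U \<phi>. local_defining_function D x U \<phi>)"

text \<open>The direction of \<open>gradient \<phi> x\<close> is the same for all defining functions \<open>\<phi>\<close> at a boundary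
  point \<open>x\<close> of a smooth domain.\<close>

definition exterior_normal :: "'a::euclidean_space set \<Rightarrow> 'a \<Rightarrow> 'a" where
  "exterior_normal D x =
     (THE \<nu>. \<exists>U \<phi>. local_defining_function D x U \<phi> \<and> \<nu> = sgn (gradient \<phi> x))"

text \<open>The one-sided derivative uses only the points \<open>x + s \<nu>\<close> with \<open>s \<le> 0\<close> small, which lie in
  the closure of \<open>D\<close>.\<close>

definition has_normal_derivative ::
  "'a::euclidean_space set \<Rightarrow> ('a \<Rightarrow> real) \<Rightarrow> 'a \<Rightarrow> real \<Rightarrow> bool" where
  "has_normal_derivative D f x d \<longleftrightarrow>
     ((\<lambda>s. f (x + s *\<^sub>R exterior_normal D x)) has_real_derivative d) (at_left 0)"

definition zero_point :: "'a::euclidean_space set \<Rightarrow> ('a \<Rightarrow> real) \<Rightarrow> 'a \<Rightarrow> bool" where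
  "zero_point D a x \<longleftrightarrow> x \<in> closure D \<and> a x = 0"

definition zero_order :: "'a::euclidean_space set \<Rightarrow> ('a \<Rightarrow> real) \<Rightarrow> 'a \<Rightarrow> ereal" where
  "zero_order D a x0 =
     Sup {ereal s | s. 0 \<le> s \<and> a \<in> O[at x0 within closure D](\<lambda>x. norm (x - x0) powr s)}"


section \<open>Classical solutions\<close>

text \<open>\<open>C21_on D T u\<close>: the derivatives \<open>u\<^sub>t\<close>, \<open>\<partial>\<^sub>b u\<close> and \<open>\<partial>\<^sub>c \<partial>\<^sub>b u\<close> exist and, like \<open>u\<close>, are
  jointly continuous on \<open>D \<times> (0,T)\<close>.\<close>

definition C21_on ::
  "'a::euclidean_space set \<Rightarrow> ereal \<Rightarrow> ('a \<Rightarrow> real \<Rightarrow> real) \<Rightarrow> bool" where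
  "C21_on D T u \<longleftrightarrow>
     (\<forall>x\<in>D. \<forall>t. 0 < t \<and> ereal t < T \<longrightarrow>
        (\<lambda>s. u x s) differentiable (at t) \<and>
        (\<lambda>y. u y t) differentiable (at x) \<and>
        (\<forall>b\<in>Basis. dir_deriv b (\<lambda>y. u y t) differentiable (at x))) \<and>
     (let Q = D \<times> {t. 0 < t \<and> ereal t < T} in
        continuous_on Q (\<lambda>(x, t). u x t) \<and>
        continuous_on Q (\<lambda>(x, t). deriv (\<lambda>s. u x s) t) \<and>
        (\<forall>b\<in>Basis. continuous_on Q (\<lambda>(x, t). dir_deriv b (\<lambda>y. u y t) x)) \<and>
        (\<forall>b\<in>Basis. \<forall>c\<in>Basis.
           continuous_on Q (\<lambda>(x, t). dir_deriv c (dir_deriv b (\<lambda>y. u y t)) x)))"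

text \<open>Nonnegativity is included, so that the real powers are the mathematical ones
  (\<open>0 powr p = 0\<close>).\<close>

definition solves_equation ::
  "'a::euclidean_space set \<Rightarrow> ('a \<Rightarrow> real) \<Rightarrow> real \<Rightarrow> real \<Rightarrow> real \<Rightarrow> ereal \<Rightarrow>
   ('a \<Rightarrow> real \<Rightarrow> real) \<Rightarrow> bool" where
  "solves_equation D a \<mu> p q T u \<longleftrightarrow>
     0 < T \<and> C21_on D T u \<and>
     (\<forall>x\<in>closure D. \<forall>t. 0 \<le> t \<and> ereal t < T \<longrightarrow> 0 \<le> u x t) \<and>
     (\<forall>x\<in>D. \<forall>t. 0 < t \<and> ereal t < T \<longrightarrow>
        deriv (\<lambda>s. u x s) t =
          laplacian (\<lambda>y. u y t) x + \<mu> * u x t powr p - a x * u x t powr q)"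

text \<open>The initial value \<open>u0\<close> need not vanish on the boundary.  For such \<open>u0\<close> a solution of the
  Dirichlet problem is discontinuous at the corner \<open>frontier D \<times> {0}\<close>, so continuity is required
  off the corner only, together with boundedness for small times; if \<open>u0 = 0\<close> on the boundary,
  this forces continuity at the corner as well.\<close>

definition dirichlet_solution ::
  "'a::euclidean_space set \<Rightarrow> ('a \<Rightarrow> real) \<Rightarrow> real \<Rightarrow> real \<Rightarrow> real \<Rightarrow> ('a \<Rightarrow> real) \<Rightarrow>
   ('a \<Rightarrow> real \<Rightarrow> real) \<Rightarrow> ereal \<Rightarrow> bool" where
  "dirichlet_solution D a \<mu> p q u0 u T \<longleftrightarrow>
     solves_equation D a \<mu> p q T u \<and>
     (\<forall>x\<in>closure D. u x 0 = u0 x) \<and>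
     (\<forall>x\<in>frontier D. \<forall>t. 0 < t \<and> ereal t < T \<longrightarrow> u x t = 0) \<and>
     continuous_on (closure D \<times> {t. 0 \<le> t \<and> ereal t < T} - frontier D \<times> {0})
       (\<lambda>(x, t). u x t) \<and>
     (\<exists>\<tau>>0. \<exists>M. ereal \<tau> < T \<and> (\<forall>x\<in>closure D. \<forall>t\<in>{0..\<tau>}. u x t \<le> M))"

definition neumann_solution ::
  "'a::euclidean_space set \<Rightarrow> ('a \<Rightarrow> real) \<Rightarrow> real \<Rightarrow> real \<Rightarrow> real \<Rightarrow> ('a \<Rightarrow> real) \<Rightarrow>
   ('a \<Rightarrow> real \<Rightarrow> real) \<Rightarrow> ereal \<Rightarrow> bool" where
  "neumann_solution D a \<mu> p q u0 u T \<longleftrightarrow>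
     solves_equation D a \<mu> p q T u \<and>
     (\<forall>x\<in>closure D. u x 0 = u0 x) \<and>
     (\<forall>x\<in>frontier D. \<forall>t. 0 < t \<and> ereal t < T \<longrightarrow> has_normal_derivative D (\<lambda>y. u y t) x 0) \<and>
     continuous_on (closure D \<times> {t. 0 \<le> t \<and> ereal t < T}) (\<lambda>(x, t). u x t)"

text \<open>\<open>Sol v S\<close> stands for ``\<open>v\<close> is a solution on \<open>[0,S)\<close>''; \<open>T\<close> is maximal if \<open>u\<close> has no
  continuation to a solution on a longer time interval.\<close>

definition maximal_existence_time ::
  "'a::euclidean_space set \<Rightarrow> (('a \<Rightarrow> real \<Rightarrow> real) \<Rightarrow> ereal \<Rightarrow> bool) \<Rightarrow>
   ('a \<Rightarrow> real \<Rightarrow> real) \<Rightarrow> ereal \<Rightarrow> bool" where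
  "maximal_existence_time D Sol u T \<longleftrightarrow>
     Sol u T \<and>
     (\<forall>v S. Sol v S \<and> (\<forall>x\<in>closure D. \<forall>t. 0 \<le> t \<and> ereal t < min S T \<longrightarrow> v x t = u x t) \<longrightarrow> S \<le> T)"


section \<open>Blowup\<close>

definition blows_up_in_finite_time ::
  "'a::euclidean_space set \<Rightarrow> ('a \<Rightarrow> real \<Rightarrow> real) \<Rightarrow> ereal \<Rightarrow> bool" where
  "blows_up_in_finite_time D u T \<longleftrightarrow>
     T < \<infinity> \<and>
     filterlim (\<lambda>t. SUP x\<in>closure D. \<bar>u x t\<bar>) at_top (at_left (real_of_ereal T))"

definition blowup_point ::
  "'a::euclidean_space set \<Rightarrow> ('a \<Rightarrow> real \<Rightarrow> real) \<Rightarrow> ereal \<Rightarrow> 'a \<Rightarrow> bool" where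
  "blowup_point D u T x0 \<longleftrightarrow>
     x0 \<in> closure D \<and>
     (\<exists>x t. (\<forall>k::nat. x k \<in> closure D \<and> 0 < t k \<and> ereal (t k) < T) \<and>
        x \<longlonglongrightarrow> x0 \<and> (\<lambda>k. ereal (t k)) \<longlonglongrightarrow> T \<and>
        filterlim (\<lambda>k. \<bar>u (x k) (t k)\<bar>) at_top sequentially)"

end

theory Submission
  imports Defs
begin

text \<open>Near a point \<open>x0\<close> with \<open>a x0 > 0\<close> the absorption dominates the source, and for large \<open>K\<close> the
  function \<open>K w\<^bsup>-2/(q-1)\<^esup>\<close> is a strict supersolution that is infinite on \<open>{w = 0}\<close>.  If \<open>{w > 0}\<close>
  is a small neighbourhood of \<open>x0\<close>, comparison with \<open>u\<close> therefore needs no information about \<open>u\<close> on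
  its edge inside \<open>D\<close>, and \<open>u\<close> stays bounded near \<open>x0\<close>.  In the Dirichlet case and in the interior
  \<open>w = \<rho>\<^sup>2 - |x - x0|\<^sup>2\<close> works.  At a Neumann boundary point \<open>w = R\<^sup>2 - |x - x0|\<^sup>2 - \<kappa> \<phi>\<close> with a
  local defining function \<open>\<phi>\<close> works: the last term makes the normal derivative of \<open>w\<close> negative on the
  boundary, so that \<open>u\<close> and the supersolution cannot touch there.\<close>

section \<open>One-variable calculus and derivatives along lines\<close>

text \<open>Since \<open>h' 0 = 0\<close> at the maximum, \<open>l > 0\<close> would make
  \<open>h'\<close> positive just to the right of 0, and the mean value theorem would lift
  \<open>h\<close> above \<open>h 0\<close>.\<close>

lemma second_derivative_le_0_at_local_max:
  fixes h h' :: "real \<Rightarrow> real"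
  assumes "e > 0"
    and h: "\<And>s. \<bar>s\<bar> < e \<Longrightarrow> (h has_real_derivative h' s) (at s)"
    and h': "(h' has_real_derivative l) (at 0)"
    and max: "\<And>s. \<bar>s\<bar> < e \<Longrightarrow> h s \<le> h 0"
  shows "l \<le> 0"
proof (rule ccontr)
  assume "\<not> l \<le> 0"
  then obtain d where d: "d > 0" "\<And>s. 0 < s \<Longrightarrow> s < d \<Longrightarrow> h' 0 < h' s"
    using DERIV_pos_inc_right[OF h'] by auto
  have "h' 0 = 0"
    using DERIV_local_max[OF h[of 0] \<open>e > 0\<close>] max \<open>e > 0\<close> by simp
  define s where "s = min d e / 2"
  have s: "0 < s" "s < d" "s < e"
    using d(1) \<open>e > 0\<close> by (auto simp: s_def)
  have "\<exists>\<xi>. \<xi> > 0 \<and> \<xi> < s \<and> h s - h 0 = (s - 0) * h' \<xi>"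
    by (rule MVT2) (use s h in auto)
  then obtain \<xi> where \<xi>: "0 < \<xi>" "\<xi> < s" "h s - h 0 = s * h' \<xi>"
    by auto
  then have "h s - h 0 > 0"
    using d(2)[of \<xi>] s \<open>h' 0 = 0\<close> by simp
  then show False
    using max[of s] s by simp
qed

text \<open>The function differentiated here is the chain-rule expression for the derivative of
  \<open>f powr - \<alpha>\<close>, so the result is the second derivative of the supersolution
  profile along a line.\<close>

lemma DERIV_neg_power_deriv:
  fixes f f' :: "real \<Rightarrow> real"
  assumes "f s > 0" "(f has_real_derivative f' s) (at s)" "(f' has_real_derivative l) (at s)"
  shows "((\<lambda>s. - \<alpha> * f s powr (- \<alpha> - 1) * f' s) has_real_derivative
    \<alpha> * (\<alpha> + 1) * f s powr (- \<alpha> - 2) * (f' s)\<^sup>2 - \<alpha> * f s powr (- \<alpha> - 1) * l) (at s)"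
proof -
  have eq: "- \<alpha> - 2 = - \<alpha> - 1 - 1" by simp
  have "((\<lambda>s. f s powr (- \<alpha> - 1)) has_real_derivative
      (- \<alpha> - 1) * f s powr (- \<alpha> - 2) * f' s) (at s)"
    unfolding eq using DERIV_fun_powr[OF assms(2,1), of "- \<alpha> - 1"] by simp
  then show ?thesis
    by (auto intro!: derivative_eq_intros assms simp: algebra_simps power2_eq_square)
qed

lemma DERIV_along_line:
  assumes "f differentiable (at (x + s *\<^sub>R d))"
  shows "((\<lambda>s. f (x + s *\<^sub>R d)) has_real_derivative frechet_derivative f (at (x + s *\<^sub>R d)) d) (at s)"
proof -
  let ?f' = "frechet_derivative f (at (x + s *\<^sub>R d))"
  have f: "(f has_derivative ?f') (at (x + s *\<^sub>R d))"
    using assms frechet_derivative_works by blast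
  have "((\<lambda>s. x + s *\<^sub>R d) has_derivative (\<lambda>s. s *\<^sub>R d)) (at s)"
    by (auto intro!: derivative_eq_intros)
  from has_derivative_compose[OF this f]
  have "((\<lambda>s. f (x + s *\<^sub>R d)) has_derivative (\<lambda>s. ?f' (s *\<^sub>R d))) (at s)" .
  moreover have "(\<lambda>s. ?f' (s *\<^sub>R d)) = (*) (?f' d)"
    using linear_scale[OF has_derivative_linear[OF f]] by (auto simp: fun_eq_iff)
  ultimately show ?thesis
    by (simp add: has_field_derivative_def)
qed

text \<open>Linearity and expansion in \<open>Basis\<close>. The exterior normal is in general no
  basis vector, so derivatives along it are expressed through \<open>gradient\<close>.\<close>

lemma frechet_derivative_eq_gradient:
  assumes "f differentiable (at x)"
  shows "frechet_derivative f (at x) d = gradient f x \<bullet> d"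
proof -
  have f: "linear (frechet_derivative f (at x))"
    using assms linear_frechet_derivative by blast
  have "frechet_derivative f (at x) d = frechet_derivative f (at x) (\<Sum>b\<in>Basis. (d \<bullet> b) *\<^sub>R b)"
    by (simp add: euclidean_representation)
  also have "\<dots> = gradient f x \<bullet> d"
    by (simp add: linear_sum[OF f] linear_scale[OF f] gradient_def dir_deriv_def inner_sum_left
        inner_commute[of d] mult.commute)
  finally show ?thesis .
qed

text \<open>Left difference quotients at a maximum are nonpositive over negative. One-sidedness
  matters twice: a maximum over a time interval may sit at its right end, and at a boundary point
  only the inner side of the normal is known to lie in \<open>closure D\<close>.\<close>

lemma left_derivative_nonneg_at_max:
  fixes h :: "real \<Rightarrow> real"
  assumes "(h has_real_derivative d) (at_left t)" "\<forall>\<^sub>F s in at_left t. h s \<le> h t"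
  shows "d \<ge> 0"
proof -
  have "((\<lambda>s. (h s - h t) / (s - t)) \<longlongrightarrow> d) (at_left t)"
    using assms(1) by (simp add: has_field_derivative_iff)
  moreover have "\<forall>\<^sub>F s in at_left t. (h s - h t) / (s - t) \<ge> 0"
    using assms(2) eventually_at_left_real[of "t - 1" t, simplified]
    by eventually_elim (auto intro: divide_nonpos_neg)
  ultimately show ?thesis
    by (rule tendsto_lowerbound) simp
qed

section \<open>Local defining functions and the exterior normal\<close>

text \<open>As \<open>x\<close> lies outside the open set \<open>D\<close>,
  \<open>\<phi> x \<ge> 0\<close>. A positive value would persist on a neighbourhood missing
  \<open>D\<close>, although \<open>x\<close> is in the closure of \<open>D\<close>.\<close>

lemma local_defining_function_zero:
  assumes "open D" "x \<in> frontier D" "local_defining_function D x U \<phi>"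
  shows "\<phi> x = 0" "\<phi> differentiable (at x)"
proof -
  have U: "open U" "x \<in> U" "D \<inter> U = {y \<in> U. \<phi> y < 0}" "\<forall>k. Ck_on k U \<phi>"
    using assms(3) by (auto simp: local_defining_function_def smooth_on_def)
  show "\<phi> differentiable (at x)"
    using U(4)[rule_format, of 1] U(2) by simp
  then have cont: "isCont \<phi> x"
    using differentiable_imp_continuous_within by blast
  have "x \<notin> D" using assms(1,2) by (simp add: frontier_def interior_open)
  then have "\<phi> x \<ge> 0" using U by auto
  moreover have "\<not> \<phi> x > 0"
  proof
    assume "\<phi> x > 0"
    then have "\<forall>\<^sub>F y in at x. \<phi> y > 0"
      using order_tendstoD(1) cont isCont_def by blast
    then have "\<forall>\<^sub>F y in nhds x. \<phi> y > 0"
      using \<open>\<phi> x > 0\<close> by (auto simp: eventually_at_filter elim: eventually_mono)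
    moreover have "\<forall>\<^sub>F y in nhds x. y \<in> U"
      using U by (simp add: eventually_nhds_in_open)
    ultimately have "\<forall>\<^sub>F y in nhds x. \<phi> y > 0 \<and> y \<in> U"
      by (rule eventually_conj)
    then obtain V where V: "open V" "x \<in> V" "\<forall>y\<in>V. \<phi> y > 0 \<and> y \<in> U"
      by (auto simp: eventually_nhds)
    then have "V \<inter> D = {}"
      using U(3) by (metis (mono_tags, lifting) Int_iff disjoint_iff linorder_not_less mem_Collect_eq order_less_imp_le)
    then show False
      using V assms(2) open_Int_closure_eq_empty[of V D] by (auto simp: frontier_def)
  qed
  ultimately show "\<phi> x = 0" by simp
qed

lemma has_real_derivative_neg_right:
  fixes f :: "real \<Rightarrow> real"
  assumes "(f has_real_derivative d) (at 0)" "d < 0" "f 0 = 0"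
  shows "\<forall>\<^sub>F s in at_right 0. f s < 0"
  using DERIV_neg_dec_right[OF assms(1,2)] assms(3)
  by (auto simp: eventually_at_right_field)

text \<open>To first order \<open>\<phi>\<close> decreases along \<open>d\<close> from its value 0
  at \<open>x\<close>, so the ray starts out in the region \<open>\<phi> < 0\<close>.\<close>

lemma defining_function_inward:
  assumes "open D" "x \<in> frontier D" "local_defining_function D x U \<phi>" "gradient \<phi> x \<bullet> d < 0"
  shows "\<forall>\<^sub>F s in at_right 0. x + s *\<^sub>R d \<in> D"
proof -
  have U: "open U" "x \<in> U" "D \<inter> U = {y \<in> U. \<phi> y < 0}"
    using assms(3) by (auto simp: local_defining_function_def)
  note z = local_defining_function_zero[OF assms(1-3)]
  have "((\<lambda>s. \<phi> (x + s *\<^sub>R d)) has_real_derivative gradient \<phi> x \<bullet> d) (at 0)"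
    using DERIV_along_line[of \<phi> x 0 d] z(2) by (simp add: frechet_derivative_eq_gradient)
  then have "\<forall>\<^sub>F s in at_right 0. \<phi> (x + s *\<^sub>R d) < 0"
    by (rule has_real_derivative_neg_right) (use assms(4) z(1) in auto)
  moreover have "((\<lambda>s. x + s *\<^sub>R d) \<longlongrightarrow> x + 0 *\<^sub>R d) (at_right 0)"
    by (intro tendsto_intros)
  then have "\<forall>\<^sub>F s in at_right 0. x + s *\<^sub>R d \<in> U"
    using U(1,2) by (auto dest: topological_tendstoD)
  ultimately show ?thesis
    by eventually_elim (use U(3) in blast)
qed

text \<open>The definite description needs uniqueness. If \<open>\<phi>\<close> and
  \<open>\<psi>\<close> had distinct unit normals \<open>n\<close> and \<open>m\<close>, then a move
  from \<open>x\<close> in the direction \<open>m - n\<close> would decrease \<open>\<phi>\<close>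
  and increase \<open>\<psi>\<close>, and nearby points would lie both in \<open>D\<close> and
  outside it.\<close>

lemma exterior_normal_eq:
  assumes "open D" "x \<in> frontier D" and \<phi>: "local_defining_function D x U \<phi>"
  shows "exterior_normal D x = sgn (gradient \<phi> x)"
  unfolding exterior_normal_def
proof (rule the_equality)
  show "\<exists>U' \<phi>'. local_defining_function D x U' \<phi>' \<and> sgn (gradient \<phi> x) = sgn (gradient \<phi>' x)"
    using \<phi> by blast
next
  fix \<nu> assume "\<exists>U \<phi>. local_defining_function D x U \<phi> \<and> \<nu> = sgn (gradient \<phi> x)"
  then obtain W \<psi> where \<psi>: "local_defining_function D x W \<psi>" "\<nu> = sgn (gradient \<psi> x)"
    by blast
  have nz: "gradient \<phi> x \<noteq> 0" "gradient \<psi> x \<noteq> 0"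
    using \<phi> \<psi>(1) by (auto simp: local_defining_function_def)
  define n m where "n = sgn (gradient \<phi> x)" and "m = sgn (gradient \<psi> x)"
  have norms: "n \<bullet> n = 1" "m \<bullet> m = 1"
    using nz by (auto simp: n_def m_def norm_sgn dot_square_norm)
  show "\<nu> = sgn (gradient \<phi> x)"
  proof (rule ccontr)
    assume "\<nu> \<noteq> sgn (gradient \<phi> x)"
    \<comment> \<open>The square expands to \<open>2 - 2 * (n \<bullet> m)\<close>, which gives the
      strict Cauchy-Schwarz inequality for distinct unit vectors.\<close>
    then have "(m - n) \<bullet> (m - n) > 0"
      using \<psi>(2) by (simp add: n_def m_def)
    then have lt: "n \<bullet> m < 1"
      using norms by (simp add: inner_diff_left inner_diff_right inner_commute)
    define d where "d = m - n"
    have g: "gradient \<phi> x = norm (gradient \<phi> x) *\<^sub>R n" "gradient \<psi> x = norm (gradient \<psi> x) *\<^sub>R m"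
      using nz by (auto simp: n_def m_def sgn_div_norm)
    have "n \<bullet> d < 0" "m \<bullet> (- d) < 0"
      using lt norms by (auto simp: d_def inner_diff_left inner_diff_right inner_commute)
    then have neg: "gradient \<phi> x \<bullet> d < 0" "gradient \<psi> x \<bullet> d > 0"
      using nz by (subst g, simp add: mult_pos_neg mult_neg_pos)+
    have D: "\<forall>\<^sub>F s in at_right 0. x + s *\<^sub>R d \<in> D"
      using defining_function_inward[OF assms neg(1)] .
    note z = local_defining_function_zero[OF assms(1,2) \<psi>(1)]
    have "((\<lambda>s. - \<psi> (x + s *\<^sub>R d)) has_real_derivative - (gradient \<psi> x \<bullet> d)) (at 0)"
      using DERIV_along_line[of \<psi> x 0 d] z(2)
      by (auto intro!: derivative_eq_intros simp: frechet_derivative_eq_gradient)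
    then have "\<forall>\<^sub>F s in at_right 0. - \<psi> (x + s *\<^sub>R d) < 0"
      by (rule has_real_derivative_neg_right) (use neg z(1) in auto)
    moreover have "((\<lambda>s. x + s *\<^sub>R d) \<longlongrightarrow> x + 0 *\<^sub>R d) (at_right 0)"
      by (intro tendsto_intros)
    then have "\<forall>\<^sub>F s in at_right 0. x + s *\<^sub>R d \<in> W"
      using \<psi>(1) by (auto dest: topological_tendstoD simp: local_defining_function_def)
    ultimately have "\<forall>\<^sub>F s::real in at_right 0. False"
      using D by eventually_elim (use \<psi>(1) in \<open>force simp: local_defining_function_def\<close>)
    then show False by simp
  qed
qed

section \<open>Comparison with the singular supersolution\<close>

text \<open>The right-hand side is \<open>M\<close> times the Laplacian of
  \<open>w powr - \<alpha>\<close>, written out by the chain rule. The difference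
  \<open>f - M * w powr - \<alpha>\<close> has a local maximum at \<open>x\<close>, so the second
  derivative test applies in every basis direction.\<close>

lemma laplacian_le_at_touching_point:
  fixes f w :: "'a::euclidean_space \<Rightarrow> real"
  assumes N: "open N" "x \<in> N"
    and f: "\<And>y. y \<in> N \<Longrightarrow> f differentiable (at y)"
      "\<And>b. b \<in> Basis \<Longrightarrow> dir_deriv b f differentiable (at x)"
    and w: "\<And>y. y \<in> N \<Longrightarrow> w y > 0"
      "\<And>y. y \<in> N \<Longrightarrow> w differentiable (at y)"
      "\<And>b. b \<in> Basis \<Longrightarrow> dir_deriv b w differentiable (at x)"
    and le: "\<And>y. y \<in> N \<Longrightarrow> f y \<le> M * w y powr - \<alpha>"
    and eq: "f x = M * w x powr - \<alpha>"
  shows "laplacian f x \<le> M * (\<Sum>b\<in>Basis. \<alpha> * (\<alpha> + 1) * w x powr (- \<alpha> - 2) * (dir_deriv b w x)\<^sup>2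
    - \<alpha> * w x powr (- \<alpha> - 1) * dir_deriv b (dir_deriv b w) x)"
  unfolding laplacian_def sum_distrib_left
proof (rule sum_mono)
  fix b :: 'a assume b: "b \<in> Basis"
  obtain e where e: "e > 0" "\<And>y. dist y x < e \<Longrightarrow> y \<in> N"
    using N open_dist by metis
  have inN: "x + s *\<^sub>R b \<in> N" if "\<bar>s\<bar> < e" for s
    using that b by (intro e(2)) (simp add: dist_norm)
  have line: "((\<lambda>s. g (x + s *\<^sub>R b)) has_real_derivative dir_deriv b g (x + s *\<^sub>R b)) (at s)"
    if "g differentiable (at (x + s *\<^sub>R b))" for g s
    using DERIV_along_line[OF that] by (simp add: dir_deriv_def)
  define h where "h = (\<lambda>s. f (x + s *\<^sub>R b) - M * w (x + s *\<^sub>R b) powr - \<alpha>)"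
  define h' where "h' = (\<lambda>s. dir_deriv b f (x + s *\<^sub>R b) -
    M * (- \<alpha> * w (x + s *\<^sub>R b) powr (- \<alpha> - 1) * dir_deriv b w (x + s *\<^sub>R b)))"
  define l where "l = dir_deriv b (dir_deriv b f) x -
    M * (\<alpha> * (\<alpha> + 1) * w x powr (- \<alpha> - 2) * (dir_deriv b w x)\<^sup>2
      - \<alpha> * w x powr (- \<alpha> - 1) * dir_deriv b (dir_deriv b w) x)"
  have "l \<le> 0"
  proof (rule second_derivative_le_0_at_local_max[OF e(1), of h h'])
    fix s :: real assume s: "\<bar>s\<bar> < e"
    have w': "((\<lambda>s. w (x + s *\<^sub>R b)) has_real_derivative dir_deriv b w (x + s *\<^sub>R b)) (at s)"
      by (rule line[OF w(2)[OF inN[OF s]]])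
    have "((\<lambda>s. w (x + s *\<^sub>R b) powr - \<alpha>) has_real_derivative
        - \<alpha> * w (x + s *\<^sub>R b) powr (- \<alpha> - 1) * dir_deriv b w (x + s *\<^sub>R b)) (at s)"
      using DERIV_fun_powr[OF w', of "- \<alpha>"] w(1)[OF inN[OF s]] by simp
    then show "(h has_real_derivative h' s) (at s)"
      unfolding h_def h'_def
      by (intro DERIV_diff DERIV_cmult line f(1) inN s)
    show "h s \<le> h 0"
      using le[OF inN[OF s]] eq by (simp add: h_def)
  next
    show "(h' has_real_derivative l) (at 0)"
      unfolding h'_def l_def
      using DERIV_neg_power_deriv[of "\<lambda>s. w (x + s *\<^sub>R b)" 0 "\<lambda>s. dir_deriv b w (x + s *\<^sub>R b)"
          "dir_deriv b (dir_deriv b w) x" \<alpha>]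
        line[of w 0] line[of "dir_deriv b w" 0] line[of "dir_deriv b f" 0] w N f b
      by (intro DERIV_diff DERIV_cmult) simp_all
  qed
  then show "dir_deriv b (dir_deriv b f) x \<le> M * (\<alpha> * (\<alpha> + 1) * w x powr (- \<alpha> - 2) * (dir_deriv b w x)\<^sup>2
      - \<alpha> * w x powr (- \<alpha> - 1) * dir_deriv b (dir_deriv b w) x)"
    by (simp add: l_def)
qed

text \<open>Half of the absorption is spent on each of the other two terms. With the exponent
  \<open>2 / (q - 1)\<close>, the power \<open>m powr (q - 1)\<close> scales like
  \<open>w powr - 2\<close> and beats the diffusion term. Since \<open>w \<le> W\<close>, the value
  \<open>m\<close> is also bounded below, far enough for \<open>m powr q\<close> to beat the lower
  power \<open>m powr p\<close>.\<close>

lemma absorption_dominates: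
  fixes p q \<mu> c C W :: real
  assumes "1 < p" "p < q" "0 < \<mu>" "0 < c" "0 < W" "0 \<le> C"
  obtains K where "K > 0"
    "\<And>w m. 0 < w \<Longrightarrow> w \<le> W \<Longrightarrow> m > K * w powr - (2 / (q - 1)) \<Longrightarrow>
       C * m * w powr - 2 + \<mu> * m powr p - c * m powr q < 0"
proof -
  define \<alpha> where "\<alpha> = 2 / (q - 1)"
  \<comment> \<open>\<open>K1\<close> handles the diffusion term and \<open>K2\<close> the source
    term. The \<open>+ 1\<close> makes the first comparison strict and keeps \<open>K1\<close>
    positive when \<open>C = 0\<close>.\<close>
  define K1 K2 where "K1 = (2 * C / c + 1) powr (1 / (q - 1))"
    and "K2 = (2 * \<mu> / c) powr (1 / (q - p)) * W powr \<alpha>"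
  define K where "K = max K1 K2"
  have "2 * C / c + 1 > 0"
    using assms by (intro add_nonneg_pos divide_nonneg_pos) auto
  then have "K1 > 0"
    by (simp add: K1_def)
  then have "K > 0" by (simp add: K_def)
  moreover have "C * m * w powr - 2 + \<mu> * m powr p - c * m powr q < 0"
    if w: "0 < w" "w \<le> W" and m: "m > K * w powr - \<alpha>" for w m
  proof -
    have "K * w powr - \<alpha> > 0"
      using \<open>K > 0\<close> w(1) by simp
    then have m0: "m > 0"
      using m by linarith
    have "C * w powr - 2 < c / 2 * m powr (q - 1)"
    proof -
      have "\<alpha> * (q - 1) = 2"
        using assms nonzero_divide_eq_eq[of "q - 1" 2 \<alpha>] by (simp add: \<alpha>_def)
      then have "(w powr - \<alpha>) powr (q - 1) = w powr - 2"
        by (simp add: powr_powr)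
      then
      have "(2 * C / c + 1) * w powr - 2 = (K1 * w powr - \<alpha>) powr (q - 1)"
        using assms \<open>2 * C / c + 1 > 0\<close> w
        by (simp add: powr_mult K1_def powr_powr del: minus_mult_left)
      also have "\<dots> \<le> m powr (q - 1)"
      proof (rule powr_mono2)
        have "K1 * w powr - \<alpha> \<le> K * w powr - \<alpha>"
          by (intro mult_right_mono) (auto simp: K_def)
        then show "K1 * w powr - \<alpha> \<le> m" using m by simp
      qed (use assms \<open>K1 > 0\<close> in auto)
      finally have "c / 2 * ((2 * C / c + 1) * w powr - 2) \<le> c / 2 * m powr (q - 1)"
        using assms by (intro mult_left_mono) auto
      moreover have "c / 2 * ((2 * C / c + 1) * w powr - 2) = C * w powr - 2 + c / 2 * w powr - 2"
        using assms by (simp add: field_simps)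
      moreover have "c / 2 * w powr - 2 > 0"
        using assms w by simp
      ultimately show ?thesis by linarith
    qed
    then have 1: "C * w powr - 2 * m < c / 2 * m powr (q - 1) * m"
      using m0 by (rule mult_strict_right_mono)
    \<comment> \<open>The factor \<open>W powr \<alpha>\<close> in \<open>K2\<close> compensates the
      smallest possible value of \<open>w powr - \<alpha>\<close>, so \<open>m\<close> is at least
      \<open>(2 * \<mu> / c) powr (1 / (q - p))\<close>.\<close>
    have "2 * \<mu> / c \<le> m powr (q - p)"
    proof -
      have "W powr \<alpha> * w powr - \<alpha> \<ge> 1"
        using w assms powr_mono2[of \<alpha> w W] by (simp add: powr_minus field_simps \<alpha>_def)
      then have "(2 * \<mu> / c) powr (1 / (q - p)) * 1 \<le> (2 * \<mu> / c) powr (1 / (q - p)) * (W powr \<alpha> * w powr - \<alpha>)"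
        by (intro mult_left_mono) auto
      also have "\<dots> \<le> K * w powr - \<alpha>"
        unfolding mult.assoc[symmetric] K2_def[symmetric]
        by (intro mult_right_mono) (auto simp: K_def)
      finally have "(2 * \<mu> / c) powr (1 / (q - p)) \<le> m"
        using m by simp
      then have "((2 * \<mu> / c) powr (1 / (q - p))) powr (q - p) \<le> m powr (q - p)"
        using assms by (intro powr_mono2) auto
      then show ?thesis
        using assms by (simp add: powr_powr)
    qed
    then have "\<mu> \<le> c / 2 * m powr (q - p)"
      using assms by (simp add: field_simps)
    then have "\<mu> * m powr p \<le> c / 2 * m powr (q - p) * m powr p"
      by (rule mult_right_mono) simp
    also have "\<dots> = c / 2 * m powr q"
      using m0 by (simp flip: powr_add)
    finally have 2: "\<mu> * m powr p \<le> c / 2 * m powr q" .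
    have "m powr (q - 1) * m = m powr q"
      using m0 by (simp add: powr_diff)
    then show ?thesis
      using 1 2 by (simp add: algebra_simps)
  qed
  ultimately show ?thesis
    using that unfolding \<alpha>_def by blast
qed

text \<open>The quotient of \<open>u\<close> by \<open>w powr - \<alpha>\<close> is maximised over a
  compact set. A maximum above \<open>K\<close> would lie where \<open>w > 0\<close>, off the edge
  and after \<open>t0\<close>; inside \<open>D\<close> the equation forbids it, on the frontier
  \<open>bdry\<close> does. The disjunction in \<open>bdry\<close> lets one comparison serve both
  boundary conditions; in its second alternative \<open>\<nu>\<close> points outward and
  \<open>w\<close> decreases along it.\<close>

lemma local_upper_bound:
  fixes D U :: "'a::euclidean_space set" and T t0 :: real
  assumes pq: "1 < p" "p < q" "0 < \<mu>"
    and "open D"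
    and sol: "solves_equation D a \<mu> p q (ereal T) u"
    and cont: "continuous_on (closure D \<times> {0<..<T}) (\<lambda>(x, t). u x t)"
    and t0: "0 < t0" "t0 < T"
    and a: "0 < c" "\<And>x. x \<in> closure D \<Longrightarrow> dist x0 x \<le> \<rho> \<Longrightarrow> c \<le> a x"
    and U: "cball x0 \<rho> \<subseteq> U" "open U"
    and w: "Ck_on 2 U w"
    and edge: "\<And>x. x \<in> closure D \<Longrightarrow> dist x0 x = \<rho> \<Longrightarrow> w x \<le> 0"
    and bdry: "\<And>x t. x \<in> frontier D \<Longrightarrow> dist x0 x < \<rho> \<Longrightarrow> w x > 0 \<Longrightarrow> 0 < t \<Longrightarrow> t < T \<Longrightarrow>
      u x t = 0 \<or>
      (\<exists>\<nu>. gradient w x \<bullet> \<nu> < 0 \<and>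
        ((\<lambda>s. u (x + s *\<^sub>R \<nu>) t) has_real_derivative 0) (at_left 0) \<and>
        (\<forall>\<^sub>F s in at_left 0. x + s *\<^sub>R \<nu> \<in> closure D))"
  shows "\<exists>K>0. \<forall>x\<in>closure D. \<forall>t\<in>{t0..<T}. dist x0 x \<le> \<rho> \<longrightarrow> w x > 0 \<longrightarrow>
    u x t \<le> K * w x powr - (2 / (q - 1))"
proof -
  define \<alpha> where "\<alpha> = 2 / (q - 1)"
  have \<alpha>: "\<alpha> > 0" using pq by (simp add: \<alpha>_def)
  have w_diff: "w differentiable (at y)" if "y \<in> U" for y
    using w that by (simp add: numeral_2_eq_2)
  have w_diff2: "dir_deriv b w differentiable (at y)" if "y \<in> U" "b \<in> Basis" for b y
    using w that by (simp add: numeral_2_eq_2)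
  have cont_w: "continuous_on U w"
    using w_diff differentiable_imp_continuous_within
    by (blast intro: continuous_at_imp_continuous_on)
  have cont_w1: "continuous_on U (dir_deriv b w)" if "b \<in> Basis" for b
    using w_diff2[OF _ that] differentiable_imp_continuous_within
    by (blast intro: continuous_at_imp_continuous_on)
  have cont_w2: "continuous_on U (dir_deriv b (dir_deriv b w))" if "b \<in> Basis" for b
    using w that by (simp add: numeral_2_eq_2)
  \<comment> \<open>\<open>G\<close> is \<open>w powr (\<alpha> + 2)\<close> times the Laplacian of
    \<open>w powr - \<alpha>\<close> where \<open>w > 0\<close>. Being a polynomial in
    \<open>w\<close> and its derivatives, it stays continuous across \<open>w = 0\<close> and is
    bounded on the ball.\<close>
  define G where "G = (\<lambda>x. \<Sum>b\<in>Basis. \<alpha> * (\<alpha> + 1) * (dir_deriv b w x)\<^sup>2 - \<alpha> * w x * dir_deriv b (dir_deriv b w) x)"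
  have "continuous_on (cball x0 \<rho>) G"
    unfolding G_def
    by (intro continuous_intros continuous_on_subset[OF cont_w1 U(1)]
        continuous_on_subset[OF cont_w2 U(1)] continuous_on_subset[OF cont_w U(1)])
  then have "bounded (G ` cball x0 \<rho>)"
    by (simp add: compact_continuous_image compact_imp_bounded)
  then obtain C where C: "C > 0" "\<And>x. x \<in> cball x0 \<rho> \<Longrightarrow> \<bar>G x\<bar> \<le> C"
    unfolding bounded_pos by auto
  have "bounded (w ` cball x0 \<rho>)"
    by (simp add: compact_continuous_image compact_imp_bounded continuous_on_subset[OF cont_w U(1)])
  then obtain W where W: "W > 0" "\<And>x. x \<in> cball x0 \<rho> \<Longrightarrow> \<bar>w x\<bar> \<le> W"
    unfolding bounded_pos by auto
  obtain K1 where K1: "K1 > 0" "\<And>w m. 0 < w \<Longrightarrow> w \<le> W \<Longrightarrow> m > K1 * w powr - \<alpha> \<Longrightarrow>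
       C * m * w powr - 2 + \<mu> * m powr p - c * m powr q < 0"
    using absorption_dominates[of p q \<mu> c W C] pq a(1) W(1) C(1) unfolding \<alpha>_def
    by (metis order_less_imp_le)
  define S where "S = {x \<in> closure D \<inter> cball x0 \<rho>. w x \<ge> 0}"
  have "closed {x \<in> cball x0 \<rho>. w x \<ge> 0}"
    using continuous_closed_preimage[OF continuous_on_subset[OF cont_w U(1)] closed_cball, of "{0..}"]
    by (simp add: vimage_def Int_def)
  moreover have "S = (closure D \<inter> cball x0 \<rho>) \<inter> {x \<in> cball x0 \<rho>. w x \<ge> 0}"
    by (auto simp: S_def)
  ultimately have "compact S"
    using compact_Int_closed closed_Int_compact by (metis closed_closure compact_cball)
  \<comment> \<open>Multiplying \<open>u\<close> by \<open>w powr \<alpha>\<close> avoids the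
    singularity: as \<open>\<alpha> > 0\<close>, the product is continuous up to
    \<open>w = 0\<close> and vanishes there.\<close>
  define z where "z = (\<lambda>(x, t). u x t * w x powr \<alpha>)"
  have cont_z: "continuous_on (S \<times> {t0..t1}) z" if "t1 < T" for t1
  proof -
    have "continuous_on (S \<times> {t0..t1}) (\<lambda>(x, t). u x t)"
      by (rule continuous_on_subset[OF cont]) (use t0 that in \<open>auto simp: S_def\<close>)
    moreover have "continuous_on (S \<times> {t0..t1}) (\<lambda>y. w (fst y))"
      by (rule continuous_on_compose2[OF cont_w])
        (use U(1) in \<open>auto intro!: continuous_intros simp: S_def\<close>)
    then have "continuous_on (S \<times> {t0..t1}) (\<lambda>y. w (fst y) powr \<alpha>)"
      by (intro continuous_on_powr') (use \<alpha> in \<open>auto simp: S_def intro!: continuous_intros\<close>)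
    ultimately have "continuous_on (S \<times> {t0..t1}) (\<lambda>y. (\<lambda>(x, t). u x t) y * w (fst y) powr \<alpha>)"
      by (rule continuous_on_mult)
    then show ?thesis
      by (simp add: z_def case_prod_unfold)
  qed
  have "bounded (z ` (S \<times> {t0..t0}))"
    using cont_z[of t0] t0 \<open>compact S\<close>
    by (intro compact_imp_bounded compact_continuous_image compact_Times) auto
  then obtain K2 where K2: "\<And>x. x \<in> S \<Longrightarrow> \<bar>z (x, t0)\<bar> \<le> K2"
    unfolding bounded_pos by auto
  \<comment> \<open>\<open>K1\<close> serves the differential inequality; \<open>K2\<close> bounds
    \<open>z\<close> at time \<open>t0\<close>, so a maximum above \<open>K\<close> cannot occur at
    that time.\<close>
  define K where "K = max K1 K2"
  have "K > 0" using K1(1) by (simp add: K_def)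
  have "u x' t' \<le> K * w x' powr - \<alpha>"
    if x': "x' \<in> closure D" "dist x0 x' \<le> \<rho>" "w x' > 0" "t0 \<le> t'" "t' < T" for x' t'
  proof (rule ccontr)
    assume "\<not> u x' t' \<le> K * w x' powr - \<alpha>"
    then have "z (x', t') > K"
      using x'(3) by (simp add: z_def powr_minus field_simps)
    have x'S: "(x', t') \<in> S \<times> {t0..t'}"
      using x' by (simp add: S_def)
    then obtain y where y: "y \<in> S \<times> {t0..t'}" "\<And>y'. y' \<in> S \<times> {t0..t'} \<Longrightarrow> z y' \<le> z y"
      using continuous_attains_sup[OF _ _ cont_z[OF x'(5)]] compact_Times[OF \<open>compact S\<close> compact_Icc]
      by blast
    obtain x1 t1 where y_eq: "y = (x1, t1)" by fastforce
    \<comment> \<open>Where \<open>w > 0\<close>, \<open>M * w powr - \<alpha>\<close> is the least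
      multiple of \<open>w powr - \<alpha>\<close> that stays above \<open>u\<close> on the compact
      set up to \<open>t'\<close>; it touches \<open>u\<close> at \<open>(x1, t1)\<close>.\<close>
    define M where "M = z y"
    have "M > K"
      using y(2)[OF x'S] \<open>z (x', t') > K\<close> by (simp add: M_def)
    have "M > 0" using \<open>M > K\<close> \<open>K > 0\<close> by simp
    have x1: "x1 \<in> closure D" "dist x0 x1 \<le> \<rho>" "w x1 \<ge> 0" "x1 \<in> S" and t1: "t0 \<le> t1" "t1 \<le> t'"
      using y(1) y_eq by (auto simp: S_def)
    have "w x1 \<noteq> 0"
      using \<open>M > 0\<close> by (auto simp: M_def z_def y_eq)
    then have "w x1 > 0" using x1 by simp
    have "dist x0 x1 < \<rho>"
      using edge[OF x1(1)] x1(2) \<open>w x1 > 0\<close> by fastforce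
    have "t1 \<noteq> t0"
      using K2[OF x1(4)] \<open>M > K\<close> by (auto simp: M_def y_eq K_def)
    then have "t0 < t1" using t1 by simp
    have t1_range: "0 < t1" "t1 < T"
      using t0 \<open>t0 < t1\<close> t1 x' by auto
    define P where "P = {y \<in> ball x0 \<rho>. w y > 0}"
    have "open P"
    proof -
      have "ball x0 \<rho> \<subseteq> U" using U(1) by auto
      then have "open (ball x0 \<rho> \<inter> w -` {0<..})"
        by (intro continuous_open_preimage continuous_on_subset[OF cont_w]) auto
      then show ?thesis by (simp add: P_def Int_def vimage_def)
    qed
    have "x1 \<in> P"
      using \<open>dist x0 x1 < \<rho>\<close> \<open>w x1 > 0\<close> by (simp add: P_def)
    have below: "u y t \<le> M * w y powr - \<alpha>" if "y \<in> closure D" "y \<in> P" "t0 \<le> t" "t \<le> t'" for y t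
    proof -
      have "z (y, t) \<le> M"
        unfolding M_def by (rule y(2)) (use that in \<open>auto simp: S_def P_def\<close>)
      then show ?thesis
        using that(2) by (simp add: P_def z_def powr_minus field_simps)
    qed
    have touch: "u x1 t1 = M * w x1 powr - \<alpha>"
      using \<open>w x1 > 0\<close> by (simp add: M_def z_def y_eq powr_minus)
    have "w x1 powr - \<alpha> > 0" using \<open>w x1 > 0\<close> by simp
    show False
    proof (cases "x1 \<in> D")
      case True
      \<comment> \<open>At the touching point the time derivative is nonnegative. The equation makes
        it negative, because the Laplacian is at most that of the supersolution and the absorption
        dominates.\<close>
      let ?m = "u x1 t1"
      have reg: "(\<lambda>s. u x1 s) differentiable (at t1)"
        "\<And>y. y \<in> D \<Longrightarrow> (\<lambda>y. u y t1) differentiable (at y)"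
        "\<And>b. b \<in> Basis \<Longrightarrow> dir_deriv b (\<lambda>y. u y t1) differentiable (at x1)"
        and eqn: "deriv (\<lambda>s. u x1 s) t1 =
          laplacian (\<lambda>y. u y t1) x1 + \<mu> * ?m powr p - a x1 * ?m powr q"
        using sol True t1_range by (auto simp: solves_equation_def C21_on_def)
      have "deriv (\<lambda>s. u x1 s) t1 \<ge> 0"
      proof (rule left_derivative_nonneg_at_max)
        show "((\<lambda>s. u x1 s) has_real_derivative deriv (\<lambda>s. u x1 s) t1) (at_left t1)"
          using reg(1) DERIV_deriv_iff_real_differentiable has_field_derivative_at_within by blast
        show "\<forall>\<^sub>F s in at_left t1. u x1 s \<le> u x1 t1"
          using eventually_at_left_real[OF \<open>t0 < t1\<close>]
          by eventually_elim (use below[OF x1(1) \<open>x1 \<in> P\<close>] touch t1 in auto)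
      qed
      moreover have "laplacian (\<lambda>y. u y t1) x1 \<le> C * ?m * w x1 powr - 2"
      proof -
        have "laplacian (\<lambda>y. u y t1) x1 \<le> M * (\<Sum>b\<in>Basis.
            \<alpha> * (\<alpha> + 1) * w x1 powr (- \<alpha> - 2) * (dir_deriv b w x1)\<^sup>2
            - \<alpha> * w x1 powr (- \<alpha> - 1) * dir_deriv b (dir_deriv b w) x1)"
          by (rule laplacian_le_at_touching_point[where N = "D \<inter> P"])
            (use \<open>open D\<close> \<open>open P\<close> \<open>x1 \<in> P\<close> True reg touch w_diff w_diff2 U(1) t1
            below closure_subset[of D] in \<open>auto simp: P_def subset_iff\<close>)
        also have "\<dots> = M * (w x1 powr - \<alpha> * w x1 powr - 2 * G x1)"
        proof -
          have eq: "- \<alpha> - 1 = - \<alpha> - 2 + 1" by simp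
          have "w x1 powr (- \<alpha> - 1) = w x1 powr (- \<alpha> - 2) * w x1"
            unfolding eq powr_add using \<open>w x1 > 0\<close> by simp
          moreover have "w x1 powr (- \<alpha> - 2) = w x1 powr - \<alpha> * w x1 powr - 2"
            by (simp flip: powr_add)
          ultimately show ?thesis
            by (simp add: G_def sum_distrib_left algebra_simps)
        qed
        also have "\<dots> = ?m * w x1 powr - 2 * G x1"
          by (simp add: touch)
        also have "\<dots> \<le> ?m * w x1 powr - 2 * C"
        proof (rule mult_left_mono)
          show "G x1 \<le> C"
            using C(2)[of x1] x1(2) by simp
          show "0 \<le> ?m * w x1 powr - 2"
            using touch \<open>M > 0\<close> by simp
        qed
        finally show ?thesis by (simp add: mult_ac)
      qed
      moreover have "C * ?m * w x1 powr - 2 + \<mu> * ?m powr p - c * ?m powr q < 0"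
      proof (rule K1(2)[OF \<open>w x1 > 0\<close>])
        show "w x1 \<le> W" using W(2)[of x1] x1(2) by simp
        have "K1 < M" using \<open>M > K\<close> by (simp add: K_def)
        then show "K1 * w x1 powr - \<alpha> < ?m"
          unfolding touch using \<open>w x1 powr - \<alpha> > 0\<close> by (rule mult_strict_right_mono)
      qed
      moreover have "c * ?m powr q \<le> a x1 * ?m powr q"
        using a(2)[OF x1(1,2)] by (intro mult_right_mono) auto
      ultimately show False using eqn by linarith
    next
      case False
      then have "x1 \<in> frontier D"
        using x1(1) \<open>open D\<close> by (simp add: frontier_def interior_open)
      moreover have "u x1 t1 \<noteq> 0"
        using touch \<open>M > 0\<close> \<open>w x1 > 0\<close> by simp
      ultimately obtain \<nu> where \<nu>: "gradient w x1 \<bullet> \<nu> < 0"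
        "((\<lambda>s. u (x1 + s *\<^sub>R \<nu>) t1) has_real_derivative 0) (at_left 0)"
        "\<forall>\<^sub>F s in at_left 0. x1 + s *\<^sub>R \<nu> \<in> closure D"
        using bdry[OF _ \<open>dist x0 x1 < \<rho>\<close> \<open>w x1 > 0\<close> t1_range] by blast
      \<comment> \<open>Along \<open>\<nu>\<close> the difference of \<open>u\<close> and the
        supersolution has a maximum from the left, so its left derivative is nonnegative. As
        \<open>u\<close> contributes 0, this derivative is a positive multiple of \<open>?d\<close>,
        which is negative.\<close>
      let ?d = "gradient w x1 \<bullet> \<nu>"
      have "w differentiable (at x1)"
        using w_diff x1(2) U(1) by auto
      then have "((\<lambda>s. w (x1 + s *\<^sub>R \<nu>)) has_real_derivative ?d) (at 0)"
        using DERIV_along_line[of w x1 0 \<nu>] by (simp add: frechet_derivative_eq_gradient)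
      from DERIV_fun_powr[OF this, of "- \<alpha>"] \<open>w x1 > 0\<close>
      have v': "((\<lambda>s. w (x1 + s *\<^sub>R \<nu>) powr - \<alpha>) has_real_derivative
          - \<alpha> * w x1 powr (- \<alpha> - 1) * ?d) (at_left 0)"
        by (simp add: has_field_derivative_at_within)
      have "0 - M * (- \<alpha> * w x1 powr (- \<alpha> - 1) * ?d) \<ge> 0"
      proof (rule left_derivative_nonneg_at_max)
        show "((\<lambda>s. u (x1 + s *\<^sub>R \<nu>) t1 - M * w (x1 + s *\<^sub>R \<nu>) powr - \<alpha>) has_real_derivative
            0 - M * (- \<alpha> * w x1 powr (- \<alpha> - 1) * ?d)) (at_left 0)"
          by (intro DERIV_diff DERIV_cmult \<nu>(2) v')
        have "((\<lambda>s. x1 + s *\<^sub>R \<nu>) \<longlongrightarrow> x1 + 0 *\<^sub>R \<nu>) (at_left 0)"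
          by (intro tendsto_intros)
        then have "\<forall>\<^sub>F s in at_left 0. x1 + s *\<^sub>R \<nu> \<in> P"
          using \<open>open P\<close> \<open>x1 \<in> P\<close> by (auto dest: topological_tendstoD)
        then show "\<forall>\<^sub>F s in at_left 0. u (x1 + s *\<^sub>R \<nu>) t1 - M * w (x1 + s *\<^sub>R \<nu>) powr - \<alpha> \<le>
            u (x1 + 0 *\<^sub>R \<nu>) t1 - M * w (x1 + 0 *\<^sub>R \<nu>) powr - \<alpha>"
          using \<nu>(3) by eventually_elim (use below touch t1 in auto)
      qed
      moreover have "M * (\<alpha> * w x1 powr (- \<alpha> - 1)) * ?d < 0"
        using \<open>M > 0\<close> \<alpha> \<open>w x1 > 0\<close> \<nu>(1) by (intro mult_pos_neg) auto
      ultimately show False by (simp add: mult.assoc)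
    qed
  qed
  then show ?thesis
    using \<open>K > 0\<close> unfolding \<alpha>_def by (intro exI[of _ K]) auto
qed

section \<open>Barriers and the exclusion of blowup points\<close>

text \<open>By continuity \<open>w\<close> exceeds \<open>w x0 / 2\<close> near \<open>x0\<close>,
  so the singular bound becomes the constant \<open>K * (w x0 / 2) powr - \<alpha>\<close> along
  every sequence tending to \<open>x0\<close> and \<open>T\<close>.\<close>

lemma not_blowup_point_if_dominated:
  fixes D :: "'a::euclidean_space set" and T t0 :: real
  assumes "isCont w x0" "w x0 > 0" "\<rho> > 0" "t0 < T" "\<alpha> > 0"
    and nonneg: "\<And>x t. x \<in> closure D \<Longrightarrow> 0 \<le> t \<Longrightarrow> t < T \<Longrightarrow> 0 \<le> u x t"
    and dominated: "\<exists>K>0. \<forall>x\<in>closure D. \<forall>t\<in>{t0..<T}. dist x0 x \<le> \<rho> \<longrightarrow> w x > 0 \<longrightarrow>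
      u x t \<le> K * w x powr - \<alpha>"
  shows "\<not> blowup_point D u (ereal T) x0"
proof
  from dominated obtain K where "K > 0"
    and bound: "\<And>x t. x \<in> closure D \<Longrightarrow> dist x0 x \<le> \<rho> \<Longrightarrow> w x > 0 \<Longrightarrow> t0 \<le> t \<Longrightarrow> t < T \<Longrightarrow>
      u x t \<le> K * w x powr - \<alpha>"
    by (auto simp: Ball_def)
  assume "blowup_point D u (ereal T) x0"
  then obtain x t where xt: "\<And>k::nat. x k \<in> closure D" "\<And>k. 0 < t k" "\<And>k. t k < T"
    and x: "x \<longlonglongrightarrow> x0" and t: "t \<longlonglongrightarrow> T"
    and blowup: "filterlim (\<lambda>k. \<bar>u (x k) (t k)\<bar>) at_top sequentially"
    unfolding blowup_point_def by auto
  have "(\<lambda>k. w (x k)) \<longlonglongrightarrow> w x0"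
    using isCont_tendsto_compose[OF assms(1) x] .
  then have "\<forall>\<^sub>F k in sequentially. w (x k) > w x0 / 2"
    using assms(2) by (intro order_tendstoD(1)) auto
  moreover have "\<forall>\<^sub>F k in sequentially. dist (x k) x0 < \<rho>"
    using tendstoD[OF x \<open>\<rho> > 0\<close>] .
  moreover have "\<forall>\<^sub>F k in sequentially. t k > t0"
    using order_tendstoD(1)[OF t \<open>t0 < T\<close>] .
  moreover have "\<forall>\<^sub>F k in sequentially. \<bar>u (x k) (t k)\<bar> > K * (w x0 / 2) powr - \<alpha>"
    using blowup by (simp add: filterlim_at_top_dense)
  ultimately have "\<forall>\<^sub>F k in sequentially. False"
  proof eventually_elim
    case (elim k)
    have "\<bar>u (x k) (t k)\<bar> = u (x k) (t k)"
      using nonneg[OF xt(1), of "t k" k] xt(2,3)[of k] by simp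
    also have "\<dots> \<le> K * w (x k) powr - \<alpha>"
      using elim assms(2) xt by (intro bound) (auto simp: dist_commute)
    also have "\<dots> \<le> K * (w x0 / 2) powr - \<alpha>"
      using elim assms(1-5) \<open>K > 0\<close> by (intro mult_left_mono powr_mono2') auto
    finally show False using elim by simp
  qed
  then show False by simp
qed

lemma dir_deriv_eq:
  assumes "(f has_derivative f') (at x)"
  shows "dir_deriv b f x = f' b"
  using frechet_derivative_at[OF assms] by (simp add: dir_deriv_def)

text \<open>One family covers both barriers: \<open>\<kappa> = 0\<close> gives the radial one, a
  local defining function \<open>\<phi>\<close> the Neumann one. \<open>Ck_on\<close> is recursive
  in \<open>dir_deriv\<close>, so the first and second derivatives are computed explicitly.\<close>

lemma barrier_regular:
  fixes \<phi> :: "'a::euclidean_space \<Rightarrow> real" and x0 :: 'a and R \<kappa> :: real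
  assumes "open U" "Ck_on 2 U \<phi>"
  defines "w \<equiv> \<lambda>x. R\<^sup>2 - (norm (x - x0))\<^sup>2 - \<kappa> * \<phi> x"
  shows "Ck_on 2 U w"
    and "x \<in> U \<Longrightarrow> gradient w x \<bullet> d = - 2 * ((x - x0) \<bullet> d) - \<kappa> * (gradient \<phi> x \<bullet> d)"
proof -
  have \<phi>: "\<phi> differentiable (at y)" if "y \<in> U" for y
    using assms(2) that by (simp add: numeral_2_eq_2)
  have \<phi>2: "dir_deriv b \<phi> differentiable (at y)" if "y \<in> U" "b \<in> Basis" for b y
    using assms(2) that by (simp add: numeral_2_eq_2)
  have \<phi>_cont: "continuous_on U (dir_deriv c (dir_deriv b \<phi>))" if "c \<in> Basis" "b \<in> Basis" for b c
    using assms(2) that by (simp add: numeral_2_eq_2)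
  have w1: "(w has_derivative (\<lambda>d. - 2 * ((y - x0) \<bullet> d) - \<kappa> * frechet_derivative \<phi> (at y) d)) (at y)"
    if "y \<in> U" for y
    unfolding w_def power2_norm_eq_inner
    using frechet_derivative_works[THEN iffD1, OF \<phi>[OF that]]
    by (auto intro!: derivative_eq_intros simp: inner_commute algebra_simps)
  have dw: "dir_deriv b w y = - 2 * ((y - x0) \<bullet> b) - \<kappa> * dir_deriv b \<phi> y" if "y \<in> U" for y b
    using dir_deriv_eq[OF w1[OF that]] by (simp add: dir_deriv_def)
  have w2: "(dir_deriv b w has_derivative
      (\<lambda>d. - 2 * (d \<bullet> b) - \<kappa> * frechet_derivative (dir_deriv b \<phi>) (at y) d)) (at y)"
    if y: "y \<in> U" and b: "b \<in> Basis" for y b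
  proof (rule has_derivative_transform_within_open[OF _ assms(1) y])
    \<comment> \<open>The formula \<open>dw\<close> holds on \<open>U\<close> only; since
      \<open>U\<close> is open, it may be differentiated in place of
      \<open>dir_deriv b w\<close>.\<close>
    show "((\<lambda>y. - 2 * ((y - x0) \<bullet> b) - \<kappa> * dir_deriv b \<phi> y) has_derivative
      (\<lambda>d. - 2 * (d \<bullet> b) - \<kappa> * frechet_derivative (dir_deriv b \<phi>) (at y) d)) (at y)"
      using frechet_derivative_works[THEN iffD1, OF \<phi>2[OF y b]]
      by (auto intro!: derivative_eq_intros simp: algebra_simps)
  qed (simp add: dw)
  have ddw: "dir_deriv c (dir_deriv b w) y = - 2 * (c \<bullet> b) - \<kappa> * dir_deriv c (dir_deriv b \<phi>) y"
    if "y \<in> U" "b \<in> Basis" for y b c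
    using dir_deriv_eq[OF w2[OF that]] by (simp add: dir_deriv_def)
  have "continuous_on U (dir_deriv c (dir_deriv b w))" if "c \<in> Basis" "b \<in> Basis" for b c
  proof -
    have "continuous_on U (\<lambda>y. - 2 * (c \<bullet> b) - \<kappa> * dir_deriv c (dir_deriv b \<phi>) y)"
      by (intro continuous_intros \<phi>_cont that)
    then show ?thesis
      using that(2) by (simp add: ddw cong: continuous_on_cong)
  qed
  then show "Ck_on 2 U w"
    by (auto simp: numeral_2_eq_2 intro: differentiableI[OF w1] differentiableI[OF w2])
  show "gradient w x \<bullet> d = - 2 * ((x - x0) \<bullet> d) - \<kappa> * (gradient \<phi> x \<bullet> d)" if "x \<in> U"
  proof -
    have "gradient w x \<bullet> d = frechet_derivative w (at x) d"
      using w1[OF that] by (intro frechet_derivative_eq_gradient[symmetric]) (auto simp: differentiable_def)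
    then show ?thesis
      using frechet_derivative_at[OF w1[OF that], symmetric]
      by (simp add: frechet_derivative_eq_gradient[OF \<phi>[OF that]])
  qed
qed

lemma Ck_on_zero: "Ck_on k U (\<lambda>_. 0)"
proof (induction k)
  case (Suc k)
  have "dir_deriv b (\<lambda>_. 0) = (\<lambda>_. 0)" for b :: 'a
    by (rule ext, rule dir_deriv_eq[where f' = "\<lambda>_. 0", THEN trans]) auto
  then show ?case using Suc by simp
qed simp

text \<open>The radial barrier vanishes on the sphere of radius \<open>\<rho>\<close>. Zero boundary
  values are asked for only inside the ball, so interior points are covered under either boundary
  condition once the ball misses the frontier.\<close>

lemma not_blowup_point_dirichlet:
  fixes D :: "'a::euclidean_space set" and T :: real
  assumes pq: "1 < p" "p < q" "0 < \<mu>"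
    and "open D"
    and sol: "solves_equation D a \<mu> p q (ereal T) u"
    and cont: "continuous_on (closure D \<times> {0<..<T}) (\<lambda>(x, t). u x t)"
    and a: "0 < c" "\<And>x. x \<in> closure D \<Longrightarrow> dist x0 x \<le> \<rho> \<Longrightarrow> c \<le> a x"
    and "\<rho> > 0"
    and bdry: "\<And>x t. x \<in> frontier D \<Longrightarrow> dist x0 x < \<rho> \<Longrightarrow> 0 < t \<Longrightarrow> t < T \<Longrightarrow> u x t = 0"
  shows "\<not> blowup_point D u (ereal T) x0"
proof -
  define w where "w = (\<lambda>x. \<rho>\<^sup>2 - (norm (x - x0))\<^sup>2 - 0 * 0)"
    \<comment> \<open>the shape of \<open>barrier_regular\<close> with \<open>\<kappa> = 0\<close> and \<open>\<phi> = 0\<close>\<close>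
  have T: "0 < T" "\<And>x t. x \<in> closure D \<Longrightarrow> 0 \<le> t \<Longrightarrow> t < T \<Longrightarrow> 0 \<le> u x t"
    using sol by (auto simp: solves_equation_def)
  have C2: "Ck_on 2 UNIV w"
    unfolding w_def by (rule barrier_regular(1)) (auto simp: Ck_on_zero)
  \<comment> \<open>Starting at \<open>T / 2\<close> keeps the comparison away from time 0, and
    blowup concerns only times near \<open>T\<close>.\<close>
  have "\<exists>K>0. \<forall>x\<in>closure D. \<forall>t\<in>{T / 2..<T}. dist x0 x \<le> \<rho> \<longrightarrow> w x > 0 \<longrightarrow>
    u x t \<le> K * w x powr - (2 / (q - 1))"
  proof (rule local_upper_bound[OF pq \<open>open D\<close> sol cont, where c = c and U = UNIV])
    show "w x \<le> 0" if "dist x0 x = \<rho>" for x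
      using that by (simp add: w_def dist_norm norm_minus_commute)
  qed (use T a bdry C2 in auto)
  moreover have "isCont w x0"
    unfolding w_def by (intro continuous_intros)
  ultimately show ?thesis
    using T \<open>\<rho> > 0\<close> pq
    by (intro not_blowup_point_if_dominated[where w = w and \<rho> = \<rho> and ?t0.0 = "T / 2"
          and \<alpha> = "2 / (q - 1)"]) (auto simp: w_def)
qed

text \<open>On the boundary \<open>\<phi> = 0\<close>, so \<open>w > 0\<close> forces
  \<open>norm (x - x0) < R\<close>. The quadratic part then adds less than \<open>2 * R\<close> to
  the normal derivative of \<open>w\<close>, while the term with \<open>\<kappa>\<close> adds at
  most \<open>- 4 * R\<close>. Inside \<open>D\<close> that term enlarges the region
  \<open>w > 0\<close>, and \<open>R\<close> must be small to keep it within the ball.\<close>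

lemma not_blowup_point_neumann:
  fixes D :: "'a::euclidean_space set" and T :: real
  assumes pq: "1 < p" "p < q" "0 < \<mu>"
    and "open D" "x0 \<in> frontier D" and \<phi>: "local_defining_function D x0 U \<phi>"
    and sol: "solves_equation D a \<mu> p q (ereal T) u"
    and cont: "continuous_on (closure D \<times> {0<..<T}) (\<lambda>(x, t). u x t)"
    and neumann: "\<And>x t. x \<in> frontier D \<Longrightarrow> 0 < t \<Longrightarrow> t < T \<Longrightarrow> has_normal_derivative D (\<lambda>y. u y t) x 0"
    and a: "0 < c" "\<And>x. x \<in> closure D \<Longrightarrow> dist x0 x < r \<Longrightarrow> c \<le> a x"
    and "r > 0"
  shows "\<not> blowup_point D u (ereal T) x0"
proof -
  have T: "0 < T" "\<And>x t. x \<in> closure D \<Longrightarrow> 0 \<le> t \<Longrightarrow> t < T \<Longrightarrow> 0 \<le> u x t"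
    using sol by (auto simp: solves_equation_def)
  have U: "open U" "x0 \<in> U" "\<And>k. Ck_on k U \<phi>" and grad: "\<And>y. y \<in> U \<Longrightarrow> gradient \<phi> y \<noteq> 0"
    using \<phi> by (auto simp: local_defining_function_def smooth_on_def)
  \<comment> \<open>The base point enters the definition only through \<open>x \<in> U\<close>, so
    \<open>\<phi>\<close> determines the normal at every boundary point in \<open>U\<close>.\<close>
  have defining: "local_defining_function D x U \<phi>" if "x \<in> U" for x
    using \<phi> that by (auto simp: local_defining_function_def)
  obtain \<rho>' where \<rho>': "\<rho>' > 0" "cball x0 \<rho>' \<subseteq> U"
    using U open_contains_cball by blast
  define \<rho> where "\<rho> = min \<rho>' (r / 2)"
  have \<rho>: "\<rho> > 0" "cball x0 \<rho> \<subseteq> U" "\<rho> < r"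
    using \<rho>' \<open>r > 0\<close> by (auto simp: \<rho>_def)
  have "continuous_on U \<phi>"
    using U(3)[of 0] by simp
  then have "bounded (\<phi> ` cball x0 \<rho>)"
    using \<rho>(2) by (simp add: compact_continuous_image compact_imp_bounded continuous_on_subset)
  then obtain B where B: "B > 0" "\<And>x. x \<in> cball x0 \<rho> \<Longrightarrow> \<bar>\<phi> x\<bar> \<le> B"
    unfolding bounded_pos by auto
  have "continuous_on U (gradient \<phi>)"
    unfolding gradient_def using U(3)[of 1] by (auto intro!: continuous_intros)
  then have "continuous_on (cball x0 \<rho>) (\<lambda>x. norm (gradient \<phi> x))"
    using \<rho>(2) by (intro continuous_on_norm) (rule continuous_on_subset)
  then obtain y where y: "y \<in> cball x0 \<rho>" "\<And>x. x \<in> cball x0 \<rho> \<Longrightarrow> norm (gradient \<phi> y) \<le> norm (gradient \<phi> x)"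
    using continuous_attains_inf[of "cball x0 \<rho>"] \<rho>(1) by fastforce
  \<comment> \<open>By compactness this is a positive lower bound for the length of the gradient on
    the whole ball, which makes one \<open>\<kappa>\<close> suffice.\<close>
  define m where "m = norm (gradient \<phi> y)"
  have "m > 0"
    using grad y(1) \<rho>(2) by (auto simp: m_def)
  \<comment> \<open>The quotient \<open>4 * R / m\<close> becomes \<open>\<kappa>\<close> and tends
    to 0 with \<open>R\<close>. A small \<open>R\<close> thus gives
    \<open>R\<^sup>2 + \<kappa> * B < \<rho>\<^sup>2\<close>, which makes \<open>w\<close>
    nonpositive on the sphere of radius \<open>\<rho>\<close>.\<close>
  have "((\<lambda>R. R\<^sup>2 + 4 * R / m * B) \<longlongrightarrow> 0\<^sup>2 + 4 * 0 / m * B) (at_right 0)"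
    using \<open>m > 0\<close> by (intro tendsto_intros) auto
  then have "\<forall>\<^sub>F R in at_right 0. R\<^sup>2 + 4 * R / m * B < \<rho>\<^sup>2"
    using \<rho>(1) by (intro order_tendstoD(2)) auto
  then have "\<forall>\<^sub>F R in at_right 0. R > 0 \<and> R\<^sup>2 + 4 * R / m * B < \<rho>\<^sup>2"
    using eventually_at_right_less by (rule eventually_conj[rotated])
  then obtain R where R: "R > 0" "R\<^sup>2 + 4 * R / m * B < \<rho>\<^sup>2"
    using eventually_happens'[of "at_right (0::real)"] by auto
  define \<kappa> where "\<kappa> = 4 * R / m"
  have "\<kappa> > 0" using \<open>m > 0\<close> R(1) by (simp add: \<kappa>_def)
  define w where "w = (\<lambda>x. R\<^sup>2 - (norm (x - x0))\<^sup>2 - \<kappa> * \<phi> x)"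
  note w = barrier_regular[OF U(1,3), where R = R and ?x0.0 = x0 and \<kappa> = \<kappa>, folded w_def]
  have edge: "w x \<le> 0" if "dist x0 x = \<rho>" for x
  proof -
    have "- \<phi> x \<le> B" using B(2)[of x] that by simp
    then have "\<kappa> * - \<phi> x \<le> \<kappa> * B"
      using \<open>\<kappa> > 0\<close> by (intro mult_left_mono) auto
    then show ?thesis
      using R(2) that by (simp add: w_def \<kappa>_def dist_norm norm_minus_commute)
  qed
  have bdry: "u x t = 0 \<or> (\<exists>\<nu>. gradient w x \<bullet> \<nu> < 0 \<and>
        ((\<lambda>s. u (x + s *\<^sub>R \<nu>) t) has_real_derivative 0) (at_left 0) \<and>
        (\<forall>\<^sub>F s in at_left 0. x + s *\<^sub>R \<nu> \<in> closure D))"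
    if x: "x \<in> frontier D" "dist x0 x < \<rho>" "w x > 0" and t: "0 < t" "t < T" for x t
  proof (intro disjI2 exI conjI)
    define \<nu> where "\<nu> = exterior_normal D x"
    have "x \<in> U" using x(2) \<rho>(2) by auto
    note def = defining[OF this]
    have \<nu>: "\<nu> = sgn (gradient \<phi> x)"
      unfolding \<nu>_def by (rule exterior_normal_eq[OF \<open>open D\<close> x(1) def])
    then have "norm \<nu> = 1" "gradient \<phi> x \<bullet> \<nu> = norm (gradient \<phi> x)"
      using grad[OF \<open>x \<in> U\<close>]
      by (auto simp: norm_sgn sgn_div_norm dot_square_norm power2_eq_square)
    have "\<phi> x = 0"
      by (rule local_defining_function_zero(1)[OF \<open>open D\<close> x(1) def])
    then have "(norm (x - x0))\<^sup>2 < R\<^sup>2"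
      using x(3) by (simp add: w_def)
    then have "norm (x - x0) < R"
      using R(1) by (simp add: power_less_imp_less_base)
    moreover have "- ((x - x0) \<bullet> \<nu>) \<le> norm (x - x0)"
      using Cauchy_Schwarz_ineq2[of "x - x0" \<nu>] \<open>norm \<nu> = 1\<close> by simp
    moreover have "\<kappa> * m \<le> \<kappa> * norm (gradient \<phi> x)"
      using y(2)[of x] x(2) \<open>\<kappa> > 0\<close> by (intro mult_left_mono) (auto simp: m_def)
    then have "4 * R \<le> \<kappa> * norm (gradient \<phi> x)"
      using \<open>m > 0\<close> by (simp add: \<kappa>_def)
    ultimately show "gradient w x \<bullet> \<nu> < 0"
      unfolding w(2)[OF \<open>x \<in> U\<close>] \<open>gradient \<phi> x \<bullet> \<nu> = _\<close> using R(1) by linarith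
    show "((\<lambda>s. u (x + s *\<^sub>R \<nu>) t) has_real_derivative 0) (at_left 0)"
      using neumann[OF x(1) t] by (simp add: has_normal_derivative_def \<nu>_def)
    \<comment> \<open>The direction \<open>- \<nu>\<close> points into \<open>D\<close>; reflecting
      the parameter turns this into the statement for \<open>at_left 0\<close>.\<close>
    have "gradient \<phi> x \<bullet> (- \<nu>) < 0"
      using \<open>gradient \<phi> x \<bullet> \<nu> = _\<close> grad[OF \<open>x \<in> U\<close>] by simp
    from defining_function_inward[OF \<open>open D\<close> x(1) def this]
    show "\<forall>\<^sub>F s in at_left 0. x + s *\<^sub>R \<nu> \<in> closure D"
      unfolding eventually_at_left_to_right[of _ 0]
      using closure_subset[of D] by (auto elim!: eventually_mono)
  qed
  have half: "0 < T / 2" "T / 2 < T"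
    using T(1) by simp_all
  have a': "c \<le> a x" if "x \<in> closure D" "dist x0 x \<le> \<rho>" for x
    using a(2) that \<rho>(3) by simp
  have "\<exists>K>0. \<forall>x\<in>closure D. \<forall>t\<in>{T / 2..<T}. dist x0 x \<le> \<rho> \<longrightarrow> w x > 0 \<longrightarrow>
    u x t \<le> K * w x powr - (2 / (q - 1))"
    by (rule local_upper_bound[OF pq \<open>open D\<close> sol cont half a(1) a' \<rho>(2) U(1) w(1) edge bdry])
  moreover have "isCont w x0"
    using w(1) U(2) by (simp add: numeral_2_eq_2 differentiable_imp_continuous_within)
  moreover have "w x0 > 0"
    using local_defining_function_zero(1)[OF \<open>open D\<close> \<open>x0 \<in> frontier D\<close> \<phi>] R(1)
    by (simp add: w_def)
  ultimately show ?thesis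
    using T \<rho>(1) pq
    by (intro not_blowup_point_if_dominated[where w = w and \<rho> = \<rho> and ?t0.0 = "T / 2"
          and \<alpha> = "2 / (q - 1)"]) simp_all
qed

section \<open>Assembly of the Dirichlet and Neumann cases\<close>

lemma smooth_on_closed_continuous_on:
  assumes "smooth_on_closed K f"
  shows "continuous_on K f"
proof -
  obtain V g where g: "K \<subseteq> V" "smooth_on V g" "\<And>x. x \<in> K \<Longrightarrow> f x = g x"
    using assms by (auto simp: smooth_on_closed_def)
  from g(2) have "Ck_on 0 V g"
    unfolding smooth_on_def by (rule spec)
  then have "continuous_on K g"
    using g(1) by (auto intro: continuous_on_subset)
  then show ?thesis
    by (simp add: g(3) cong: continuous_on_cong)
qed

theorem theorem1p3:
  fixes D :: "(real ^ 'n) set" and a u0 :: "real ^ 'n \<Rightarrow> real" and p q \<mu> :: real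
  assumes "q > p" and "p > 1" and "\<mu> > 0"
    and "bounded_smooth_domain D"
    and "smooth_on_closed (closure D) a" and "\<forall>x\<in>closure D. 0 \<le> a x"
    and "continuous_on (closure D) u0" and "\<forall>x\<in>closure D. 0 \<le> u0 x"
  shows "((\<forall>z. zero_point D a z \<longrightarrow> zero_order D a z \<ge> ereal (2 * (q - p) / (p - 1))) \<longrightarrow>
          (\<forall>u T. maximal_existence_time D (dirichlet_solution D a \<mu> p q u0) u T \<and>
                 blows_up_in_finite_time D u T \<longrightarrow>
             (\<forall>x0. blowup_point D u T x0 \<longrightarrow> zero_point D a x0)))
       \<and> ((\<forall>x\<in>frontier D. (\<exists>d\<le>0. has_normal_derivative D a x d) \<or> a x = 0) \<longrightarrow>
          (\<forall>u T. maximal_existence_time D (neumann_solution D a \<mu> p q u0) u T \<and>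
                 blows_up_in_finite_time D u T \<longrightarrow>
             (\<forall>x0. blowup_point D u T x0 \<longrightarrow> zero_point D a x0)))"
proof -
  have "open D" and smooth: "\<And>x. x \<in> frontier D \<Longrightarrow> \<exists>U \<phi>. local_defining_function D x U \<phi>"
    using assms(4) by (auto simp: bounded_smooth_domain_def)
  have positive_near: "\<exists>r>0. \<forall>x\<in>closure D. dist x0 x < r \<longrightarrow> a x0 / 2 \<le> a x"
    if "x0 \<in> closure D" "a x0 > 0" for x0
  proof -
    have "continuous_on (closure D) a"
      by (rule smooth_on_closed_continuous_on) fact
    from this[unfolded continuous_on_iff, rule_format, of x0 "a x0 / 2"] that
    have "\<exists>r>0. \<forall>x\<in>closure D. dist x x0 < r \<longrightarrow> dist (a x) (a x0) < a x0 / 2"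
      by simp
    then obtain r where r: "r > 0"
      "\<forall>x\<in>closure D. dist x x0 < r \<longrightarrow> \<bar>a x - a x0\<bar> < a x0 / 2"
      by (auto simp: dist_real_def)
    have "a x0 / 2 \<le> a x" if "x \<in> closure D" "dist x0 x < r" for x
    proof -
      have "\<bar>a x - a x0\<bar> < a x0 / 2"
        using r(2) that by (simp add: dist_commute)
      then show ?thesis by linarith
    qed
    then show ?thesis
      using r(1) by blast
  qed
  \<comment> \<open>Finite-time blowup excludes \<open>\<infinity>\<close>, and \<open>0 < T\<close>
    excludes \<open>- \<infinity>\<close>.\<close>
  have finite_time: "\<exists>T'. T = ereal T'"
    if "blows_up_in_finite_time D u T" "solves_equation D a \<mu> p q T u" for u T
    using that by (cases T) (auto simp: blows_up_in_finite_time_def solves_equation_def)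
  have pq: "1 < p" "p < q" "0 < \<mu>" using assms by auto
  have dirichlet_case: "zero_point D a x0"
    if max: "maximal_existence_time D (dirichlet_solution D a \<mu> p q u0) u T"
      and "blows_up_in_finite_time D u T" and bp: "blowup_point D u T x0" for u T x0
  proof -
    from max have sol: "solves_equation D a \<mu> p q T u"
      and zero: "\<And>x t. x \<in> frontier D \<Longrightarrow> 0 < t \<Longrightarrow> ereal t < T \<Longrightarrow> u x t = 0"
      and cont: "continuous_on (closure D \<times> {t. 0 \<le> t \<and> ereal t < T} - frontier D \<times> {0}) (\<lambda>(x, t). u x t)"
      unfolding maximal_existence_time_def dirichlet_solution_def by auto
    from finite_time[OF \<open>blows_up_in_finite_time D u T\<close> sol] obtain T' where T': "T = ereal T'" ..
    show ?thesis
    proof (rule ccontr)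
      assume "\<not> zero_point D a x0"
      moreover have "x0 \<in> closure D" using bp by (simp add: blowup_point_def)
      ultimately have "x0 \<in> closure D" "a x0 > 0"
        using assms(6) by (auto simp: zero_point_def order_less_le)
      from positive_near[OF this] obtain r where r: "r > 0"
        "\<And>x. x \<in> closure D \<Longrightarrow> dist x0 x < r \<Longrightarrow> a x0 / 2 \<le> a x" by blast
      have "\<not> blowup_point D u (ereal T') x0"
      proof (rule not_blowup_point_dirichlet[OF pq \<open>open D\<close> sol[unfolded T'], of "a x0 / 2" x0 "r / 2"])
        \<comment> \<open>Positive times stay off the corner \<open>frontier D \<times> {0}\<close>,
          where continuity is not assumed.\<close>
        show "continuous_on (closure D \<times> {0<..<T'}) (\<lambda>(x, t). u x t)"
          by (rule continuous_on_subset[OF cont]) (auto simp: T')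
      qed (use r zero \<open>a x0 > 0\<close> in \<open>auto simp: T'\<close>)
      then show False using bp T' by simp
    qed
  qed
  have neumann_case: "zero_point D a x0"
    if max: "maximal_existence_time D (neumann_solution D a \<mu> p q u0) u T"
      and "blows_up_in_finite_time D u T" and bp: "blowup_point D u T x0" for u T x0
  proof -
    from max have sol: "solves_equation D a \<mu> p q T u"
      and neumann: "\<And>x t. x \<in> frontier D \<Longrightarrow> 0 < t \<Longrightarrow> ereal t < T \<Longrightarrow>
        has_normal_derivative D (\<lambda>y. u y t) x 0"
      and cont: "continuous_on (closure D \<times> {t. 0 \<le> t \<and> ereal t < T}) (\<lambda>(x, t). u x t)"
      unfolding maximal_existence_time_def neumann_solution_def by auto
    from finite_time[OF \<open>blows_up_in_finite_time D u T\<close> sol] obtain T' where T': "T = ereal T'" ..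
    have cont': "continuous_on (closure D \<times> {0<..<T'}) (\<lambda>(x, t). u x t)"
      by (rule continuous_on_subset[OF cont]) (auto simp: T')
    show ?thesis
    proof (rule ccontr)
      assume "\<not> zero_point D a x0"
      moreover have "x0 \<in> closure D" using bp by (simp add: blowup_point_def)
      ultimately have x0: "x0 \<in> closure D" "a x0 > 0"
        using assms(6) by (auto simp: zero_point_def order_less_le)
      from positive_near[OF this] obtain r where r: "r > 0"
        "\<And>x. x \<in> closure D \<Longrightarrow> dist x0 x < r \<Longrightarrow> a x0 / 2 \<le> a x" by blast
      have "\<not> blowup_point D u (ereal T') x0"
      proof (cases "x0 \<in> D")
        case True
        then obtain e where e: "e > 0" "ball x0 e \<subseteq> D"
          using \<open>open D\<close> open_contains_ball by blast
        define \<rho> where "\<rho> = min e (r / 2)"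
        have "\<rho> > 0" "\<rho> < r" using e(1) r(1) by (auto simp: \<rho>_def)
        \<comment> \<open>The ball misses the frontier, so the boundary requirement of
          \<open>not_blowup_point_dirichlet\<close> holds vacuously and the radial barrier
          applies.\<close>
        have "x \<notin> frontier D" if "dist x0 x < \<rho>" for x
          using that e(2) \<open>open D\<close> by (auto simp: \<rho>_def frontier_def interior_open)
        then show ?thesis
          by (intro not_blowup_point_dirichlet[OF pq \<open>open D\<close> sol[unfolded T'] cont', of "a x0 / 2" x0 \<rho>])
            (use r \<open>\<rho> > 0\<close> \<open>\<rho> < r\<close> x0 in auto)
      next
        case False
        then have "x0 \<in> frontier D"
          using x0(1) \<open>open D\<close> by (simp add: frontier_def interior_open)
        moreover from smooth[OF this] obtain U \<phi> where "local_defining_function D x0 U \<phi>" by blast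
        ultimately show ?thesis
          by (rule not_blowup_point_neumann[OF pq \<open>open D\<close> _ _ sol[unfolded T'] cont', where c = "a x0 / 2" and r = r])
            (use neumann r x0 in \<open>auto simp: T'\<close>)
      qed
      then show False using bp T' by simp
    qed
  qed
  show ?thesis
    using dirichlet_case neumann_case by blast
qed

end
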